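(* For integers $n\geq 0$ let $P_n(x)=2^{-2n}\sum_{j=0}^{n} 2^j\binom{2n-2j}{n-j}\binom{n+j}{j}(x+1)^j$ and write $P_n(x)=\sum_{i=0}^n d_i(n)x^i$. Define $Q_n(x)=\sum_{i=0}^n \frac{d_i(n)}{i!}x^i$. Then for every $n\geq 1$, $$Q_{n+1}(x)=\left(\frac{(2n+1)x}{(n+1)^2}+\frac{8n^2+8n+3}{2(n+1)^2}\right)Q_n(x)-\frac{(4n-1)(4n+1)}{4(n+1)^2}Q_{n-1}(x)+\frac{x}{(n+1)^2}Q_n'(x).$$
   Context: $P_n(x)$ are the Boros–Moll polynomials and $d_i(n)$ their coefficients; $Q_n'$ denotes the derivative of $Q_n$ with respect to $x$. *)

theory Defs
  imports Complex_Main "HOL-Computational_Algebra.Polynomial"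
begin

definition boros_moll_poly :: "nat \<Rightarrow> real poly" where
  "boros_moll_poly n =
     smult (1 / 2 ^ (2 * n))
       (\<Sum>j = 0..n. smult (2 ^ j * real ((2 * n - 2 * j) choose (n - j)) * real ((n + j) choose j))
                      ([:1, 1:] ^ j))"

definition boros_moll_coeff :: "nat \<Rightarrow> nat \<Rightarrow> real" where
  "boros_moll_coeff i n = coeff (boros_moll_poly n) i"

definition boros_moll_Q :: "nat \<Rightarrow> real poly" where
  "boros_moll_Q n = (\<Sum>i = 0..n. monom (boros_moll_coeff i n / fact i) i)"

end

theory Submission imports Defs begin

text \<open>
  Expanding \<open>P\<^sub>n\<close> in powers of \<open>y = x + 1\<close> gives hypergeometric coefficients \<open>a\<^sub>j(n)\<close>, so every
  shift in \<open>n\<close> or \<open>j\<close> multiplies \<open>a\<^sub>j(n)\<close> by a rational function. Comparing coefficients of \<open>y\<^sup>j\<close>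
  proves
  \<open>(n+1)\<^sup>2 P\<^sub>n\<^sub>+\<^sub>1 = (2n+1) x (x P\<^sub>n)' + (8n\<^sup>2+8n+3)/2 P\<^sub>n + x P\<^sub>n' - (16n\<^sup>2-1)/4 P\<^sub>n\<^sub>-\<^sub>1\<close>.
  Dividing the coefficient of \<open>x\<^sup>i\<close> by \<open>i!\<close> turns \<open>x (x P\<^sub>n)'\<close> into \<open>x Q\<^sub>n\<close> and preserves the other
  terms, which is the claimed recurrence.
\<close>

text \<open>For \<open>j > n\<close> truncated subtraction would turn the central binomial factor
  into 1, so the cutoff at \<open>n\<close> has to be explicit.\<close>

definition shifted_coeff :: "nat \<Rightarrow> nat \<Rightarrow> real" where
  "shifted_coeff n j =
     (if j \<le> n then 2 ^ j * real ((2 * n - 2 * j) choose (n - j)) * real ((n + j) choose j) / 2 ^ (2 * n)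
      else 0)"

definition shifted_poly :: "nat \<Rightarrow> real poly" where
  "shifted_poly n = (\<Sum>j = 0..n. monom (shifted_coeff n j) j)"

lemma coeff_shifted_poly: "coeff (shifted_poly n) j = shifted_coeff n j"
  by (simp add: shifted_poly_def coeff_sum shifted_coeff_def)

lemma boros_moll_poly_eq_pcompose: "boros_moll_poly n = pcompose (shifted_poly n) [:1, 1:]"
proof -
  have "pcompose (monom c j) [:1, 1:] = smult c ([:1, 1:] ^ j)" for c :: real and j
    by (induction j) (simp_all add: monom_0 monom_Suc pcompose_pCons)
  then show ?thesis
    by (intro poly_eqI)
       (simp add: boros_moll_poly_def shifted_poly_def pcompose_sum shifted_coeff_def
         coeff_sum sum_divide_distrib)
qed

text \<open>Naming the difference \<open>k\<close> removes truncated subtraction, so index shifts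
  become plain applications of \<open>fact_Suc\<close>.\<close>

lemma shifted_coeff_fact:
  assumes "n = j + k"
  shows "shifted_coeff n j = 2 ^ j * fact (2 * k) * fact (n + j) / (fact k ^ 2 * fact n * fact j * 2 ^ (2 * n))"
  using assms by (simp add: shifted_coeff_def binomial_fact power2_eq_square)

text \<open>Term ratio in \<open>j\<close>, cleared of denominators so that it survives at
  \<open>j = n\<close>, where both sides vanish.\<close>

lemma shifted_coeff_Suc_right:
  assumes "j \<le> n"
  shows "(real j + 1) * (2 * (real n - real j) - 1) * shifted_coeff n (Suc j)
           = (real n - real j) * (real n + real j + 1) * shifted_coeff n j"
proof (cases "j = n")
  case True
  then show ?thesis by (simp add: shifted_coeff_def)
next
  case False
  then obtain k where k: "n = j + Suc k"
    using assms by (metis add.commute add_Suc_right le_neq_implies_less less_iff_Suc_add)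
  have 1: "n = Suc j + k" using k by simp
  have 2: "2 * Suc k = Suc (Suc (2 * k))" by simp
  have nz: "real k + 1 \<noteq> 0" "real j + 1 \<noteq> 0" by linarith+
  show ?thesis
    unfolding shifted_coeff_fact[OF 1] shifted_coeff_fact[OF k] 2 add_Suc_right fact_Suc
    using nz by (simp add: divide_simps k power2_eq_square) (simp add: algebra_simps)
qed

lemma shifted_coeff_Suc_left:
  assumes "j \<le> n"
  shows "2 * (real n + 1 - real j) * (real n + 1) * shifted_coeff (Suc n) j
           = (2 * (real n - real j) + 1) * (real n + real j + 1) * shifted_coeff n j"
proof -
  obtain k where k: "n = j + k"
    using assms le_Suc_ex by blast
  have 1: "Suc n = j + Suc k" using k by simp
  have 2: "2 * Suc k = Suc (Suc (2 * k))" "2 * Suc n = Suc (Suc (2 * n))" by simp_all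
  have nz: "real k + 1 \<noteq> 0" "real n + 1 \<noteq> 0" by linarith+
  show ?thesis
    unfolding shifted_coeff_fact[OF 1] shifted_coeff_fact[OF k] 2 add_Suc fact_Suc
    using nz by (simp add: divide_simps k power2_eq_square) (simp add: algebra_simps)
qed

text \<open>Supplies the leading coefficient of degree \<open>n + 1\<close>, which the ratio in
  \<open>n\<close> at fixed \<open>j \<le> n\<close> cannot reach.\<close>

lemma shifted_coeff_diagonal:
  "(real n + 1) * shifted_coeff (Suc n) (Suc n) = (2 * real n + 1) * shifted_coeff n n"
proof -
  have 1: "Suc n = Suc n + 0" "n = n + 0" by simp_all
  have 2: "2 * Suc n = Suc (Suc (2 * n))" by simp
  have nz: "real n + 1 \<noteq> 0" by linarith
  show ?thesis
    unfolding shifted_coeff_fact[OF 1(1)] shifted_coeff_fact[OF 1(2)] 2 add_Suc add_Suc_right fact_Suc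
    using nz by (simp add: divide_simps power2_eq_square) (simp add: algebra_simps)
qed

text \<open>With \<open>x = y - 1\<close>, the first bracket is the coefficient of
  \<open>y^j\<close> in \<open>(y - 1) R + (y - 1)^2 R'\<close>, that is, in
  \<open>x (x R)'\<close>. At \<open>j = 0\<close> the truncated index \<open>j - 1\<close> is
  harmless because its factor is zero.\<close>

lemma shifted_coeff_recurrence:
  fixes n j :: nat
  assumes "n \<ge> 1"
  shows "(real n + 1)\<^sup>2 * shifted_coeff (n + 1) j =
           (2 * real n + 1) * (real j * shifted_coeff n (j - 1) - (2 * real j + 1) * shifted_coeff n j
              + (real j + 1) * shifted_coeff n (j + 1))
           + (8 * (real n)\<^sup>2 + 8 * real n + 3) / 2 * shifted_coeff n j
           + real j * shifted_coeff n j - (real j + 1) * shifted_coeff n (j + 1)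
           - (4 * real n - 1) * (4 * real n + 1) / 4 * shifted_coeff (n - 1) j"
proof -
  consider "j \<le> n" | "j = n + 1" | "j > n + 1" by linarith
  then show ?thesis
  proof cases
    case 1
    define s where "s = shifted_coeff n j"
    define N J where "N = real n" and "J = real j"
    have le: "J \<le> N" "0 \<le> J" "1 \<le> N" using 1 assms by (simp_all add: N_def J_def)
    \<comment> \<open>An odd integer is nonzero; positivity would fail at \<open>j = n\<close>,
      where the value is -1.\<close>
    have odd: "2 * (N - J) - 1 \<noteq> 0"
    proof -
      have "2 * (int n - int j) - 1 \<noteq> 0" by presburger
      then have "real_of_int (2 * (int n - int j) - 1) \<noteq> 0" by linarith
      then show ?thesis by (simp add: N_def J_def)
    qed
    have nz: "N - J + 1 \<noteq> 0" "N + J \<noteq> 0" "N + 1 \<noteq> 0" using le by linarith+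
    have next_j: "(J + 1) * shifted_coeff n (j + 1) = (N - J) * (N + J + 1) * s / (2 * (N - J) - 1)"
      using shifted_coeff_Suc_right[OF 1] odd by (simp add: s_def N_def J_def field_simps)
    have next_n: "(N + 1) * shifted_coeff (n + 1) j
        = (2 * (N - J) + 1) * (N + J + 1) * s / (2 * (N - J + 1))"
      using shifted_coeff_Suc_left[OF 1] nz by (simp add: s_def N_def J_def field_simps)
    have prev_j: "J * shifted_coeff n (j - 1) = J\<^sup>2 * (2 * (N - J) + 1) * s / ((N - J + 1) * (N + J))"
    proof (cases j)
      case 0
      then show ?thesis by (simp add: J_def)
    next
      case (Suc i)
      have "J * (2 * (N - J) + 1) * s = (N - J + 1) * (N + J) * shifted_coeff n i"
        using shifted_coeff_Suc_right[of i n] Suc 1 by (simp add: s_def N_def J_def algebra_simps)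
      then have "J\<^sup>2 * (2 * (N - J) + 1) * s = J * shifted_coeff n i * ((N - J + 1) * (N + J))"
        by (simp add: power2_eq_square mult_ac)
      then show ?thesis
        using nz Suc by (simp add: nonzero_eq_divide_eq)
    qed
    \<comment> \<open>The ratio in \<open>n\<close> is used at \<open>n - 1\<close>, which requires
      \<open>j < n\<close>; at \<open>j = n\<close> both sides are zero.\<close>
    have prev_n: "shifted_coeff (n - 1) j = 2 * (N - J) * N * s / ((2 * (N - J) - 1) * (N + J))"
    proof (cases "j = n")
      case True
      then show ?thesis using assms by (simp add: shifted_coeff_def N_def J_def)
    next
      case False
      then have "j \<le> n - 1" using 1 by simp
      from shifted_coeff_Suc_left[OF this] assms
      have "2 * (N - J) * N * s = (2 * (N - J) - 1) * (N + J) * shifted_coeff (n - 1) j"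
        by (simp add: s_def N_def J_def algebra_simps of_nat_diff)
      then show ?thesis using nz odd by (simp add: nonzero_eq_divide_eq mult_ac)
    qed
    \<comment> \<open>Opaque names let \<open>divide_simps\<close> clear the denominators
      unexpanded; unfolding them afterwards leaves a polynomial identity for
      \<open>algebra\<close>.\<close>
    define A B C where "A = 2 * (N - J) - 1" and "B = N + J" and "C = N - J + 1"
    have "(N + 1) * ((2 * (N - J) + 1) * (N + J + 1) * s / (2 * C)) =
        (2 * N + 1) * (J\<^sup>2 * (2 * (N - J) + 1) * s / (C * B) - (2 * J + 1) * s
              + (N - J) * (N + J + 1) * s / A)
           + (8 * N\<^sup>2 + 8 * N + 3) / 2 * s
           + J * s - (N - J) * (N + J + 1) * s / A
           - (4 * N - 1) * (4 * N + 1) / 4 * (2 * (N - J) * N * s / (A * B))"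
    proof -
      have "A \<noteq> 0" "B \<noteq> 0" "C \<noteq> 0" using odd nz by (simp_all add: A_def B_def C_def)
      then show ?thesis
        by (simp add: divide_simps, unfold A_def B_def C_def) algebra
    qed
    then show ?thesis
      unfolding N_def[symmetric] J_def[symmetric] s_def[symmetric] next_j prev_j prev_n
        power2_eq_square[of "N + 1"] mult.assoc[of "N + 1" "N + 1"] next_n
      by (simp add: A_def B_def C_def)
  next
    case 2
    have zero: "shifted_coeff n j = 0" "shifted_coeff n (j + 1) = 0" "shifted_coeff (n - 1) j = 0"
      using 2 by (simp_all add: shifted_coeff_def)
    \<comment> \<open>Beyond degree \<open>n\<close> only the two leading coefficients
      survive.\<close>
    have "(real n + 1)\<^sup>2 * shifted_coeff (n + 1) j
        = (real n + 1) * ((2 * real n + 1) * shifted_coeff n n)"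
      using 2 shifted_coeff_diagonal[of n] by (simp add: power2_eq_square mult.assoc)
    then show ?thesis
      unfolding zero using 2 by simp
  next
    case 3
    then show ?thesis by (auto simp: shifted_coeff_def)
  qed
qed

lemma shifted_poly_recurrence:
  fixes n :: nat
  assumes "n \<ge> 1"
  defines "R \<equiv> shifted_poly n"
  shows "smult ((real n + 1)\<^sup>2) (shifted_poly (n + 1)) =
           smult (2 * real n + 1) ([:-1, 1:] * (R + [:-1, 1:] * pderiv R))
           + smult ((8 * (real n)\<^sup>2 + 8 * real n + 3) / 2) R
           + [:-1, 1:] * pderiv R
           - smult ((4 * real n - 1) * (4 * real n + 1) / 4) (shifted_poly (n - 1))"
proof (rule poly_eqI)
  fix j
  show "coeff (smult ((real n + 1)\<^sup>2) (shifted_poly (n + 1))) j =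
         coeff (smult (2 * real n + 1) ([:-1, 1:] * (R + [:-1, 1:] * pderiv R))
           + smult ((8 * (real n)\<^sup>2 + 8 * real n + 3) / 2) R
           + [:-1, 1:] * pderiv R
           - smult ((4 * real n - 1) * (4 * real n + 1) / 4) (shifted_poly (n - 1))) j"
    unfolding coeff_smult coeff_add coeff_diff coeff_shifted_poly
      shifted_coeff_recurrence[OF assms(1)] R_def
    \<comment> \<open>Two factors \<open>y - 1\<close> shift indices by up to two, so
      \<open>j = 0\<close>, \<open>j = 1\<close> and larger \<open>j\<close> are separated.\<close>
    by (cases j; cases "j - 1")
       (simp_all add: coeff_pCons coeff_pderiv coeff_shifted_poly algebra_simps)
qed

text \<open>Substituting \<open>y = x + 1\<close> turns \<open>y - 1\<close> into \<open>x\<close>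
  and commutes with differentiation; \<open>pCons 0\<close> is multiplication by
  \<open>x\<close>.\<close>

lemma boros_moll_poly_recurrence:
  fixes n :: nat
  assumes "n \<ge> 1"
  defines "P \<equiv> boros_moll_poly n"
  shows "smult ((real n + 1)\<^sup>2) (boros_moll_poly (n + 1)) =
           smult (2 * real n + 1) (pCons 0 (P + pCons 0 (pderiv P)))
           + smult ((8 * (real n)\<^sup>2 + 8 * real n + 3) / 2) P
           + pCons 0 (pderiv P)
           - smult ((4 * real n - 1) * (4 * real n + 1) / 4) (boros_moll_poly (n - 1))"
proof -
  have "pderiv P = pcompose (pderiv (shifted_poly n)) [:1, 1:]"
    by (simp add: P_def boros_moll_poly_eq_pcompose pderiv_pcompose pderiv_pCons)
  moreover have "pcompose [:-1, 1:] [:1, 1:] = [:0, 1::real:]"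
    by (simp add: pcompose_pCons)
  ultimately show ?thesis
    using arg_cong[OF shifted_poly_recurrence[OF assms(1)], of "\<lambda>p. pcompose p [:1, 1:]"]
    \<comment> \<open>Products with \<open>[:-1, 1:]\<close> must stay intact until
      \<open>pcompose_mult\<close> has acted on them.\<close>
    by (simp add: P_def boros_moll_poly_eq_pcompose pcompose_add pcompose_diff pcompose_mult
        pcompose_smult del: mult_pCons_left) simp
qed

text \<open>The sum defining \<open>boros_moll_Q\<close> stops at \<open>n\<close>, so the degree
  bound is what covers \<open>i > n\<close>.\<close>

lemma coeff_boros_moll_Q: "coeff (boros_moll_Q n) i = coeff (boros_moll_poly n) i / fact i"
proof -
  have "degree (shifted_poly n) \<le> n"
    by (rule degree_le) (simp add: coeff_shifted_poly shifted_coeff_def)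
  then have "degree (boros_moll_poly n) \<le> n"
    by (simp add: boros_moll_poly_eq_pcompose degree_pcompose)
  then show ?thesis
    by (auto simp: boros_moll_Q_def boros_moll_coeff_def coeff_sum coeff_eq_0)
qed

theorem theorem2p2:
  fixes n :: nat
  assumes "n \<ge> 1"
  shows "boros_moll_Q (n + 1) =
           (monom ((2 * real n + 1) / (real n + 1)^2) 1
              + [:(8 * (real n)^2 + 8 * real n + 3) / (2 * (real n + 1)^2):]) * boros_moll_Q n
           - smult ((4 * real n - 1) * (4 * real n + 1) / (4 * (real n + 1)^2)) (boros_moll_Q (n - 1))
           + monom (1 / (real n + 1)^2) 1 * pderiv (boros_moll_Q n)"
    (is "_ = ?rhs")
proof (rule poly_eqI)
  fix i
  define D where "D = (real n + 1)\<^sup>2"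
  have D: "D \<noteq> 0" unfolding D_def by (simp add: add_nonneg_eq_0_iff)
  have mon: "monom c 1 * p = pCons 0 (smult c p)" for c :: real and p
    by (simp add: monom_Suc monom_0)
  have rec: "D * coeff (boros_moll_poly (n + 1)) i =
      coeff (smult (2 * real n + 1) (pCons 0 (boros_moll_poly n + pCons 0 (pderiv (boros_moll_poly n))))
           + smult ((8 * (real n)\<^sup>2 + 8 * real n + 3) / 2) (boros_moll_poly n)
           + pCons 0 (pderiv (boros_moll_poly n))
           - smult ((4 * real n - 1) * (4 * real n + 1) / 4) (boros_moll_poly (n - 1))) i"
    unfolding D_def coeff_smult[symmetric] boros_moll_poly_recurrence[OF assms] ..
  have "D * coeff (boros_moll_Q (n + 1)) i = D * coeff ?rhs i"
  proof (cases i)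
    case 0
    have "D * coeff (boros_moll_Q (n + 1)) i =
        (8 * (real n)\<^sup>2 + 8 * real n + 3) / 2 * coeff (boros_moll_poly n) i
        - (4 * real n - 1) * (4 * real n + 1) / 4 * coeff (boros_moll_poly (n - 1)) i"
      using rec by (simp add: 0 coeff_boros_moll_Q)
    also have "\<dots> = D * coeff ?rhs i"
      using D unfolding D_def[symmetric] distrib_right mon
      by (simp add: 0 coeff_boros_moll_Q right_diff_distrib)
    finally show ?thesis .
  next
    case (Suc k)
    have nz: "real k + 1 \<noteq> 0" by linarith
    have "D * coeff (boros_moll_poly (n + 1)) i =
        (2 * real n + 1) * (real k + 1) * coeff (boros_moll_poly n) k
        + (8 * (real n)\<^sup>2 + 8 * real n + 3) / 2 * coeff (boros_moll_poly n) i
        + (real k + 1) * coeff (boros_moll_poly n) i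
        - (4 * real n - 1) * (4 * real n + 1) / 4 * coeff (boros_moll_poly (n - 1)) i"
      unfolding rec by (cases k) (simp_all add: Suc coeff_pderiv algebra_simps)
    then have "D * coeff (boros_moll_Q (n + 1)) i =
        ((2 * real n + 1) * (real k + 1) * coeff (boros_moll_poly n) k
        + (8 * (real n)\<^sup>2 + 8 * real n + 3) / 2 * coeff (boros_moll_poly n) i
        + (real k + 1) * coeff (boros_moll_poly n) i
        - (4 * real n - 1) * (4 * real n + 1) / 4 * coeff (boros_moll_poly (n - 1)) i) / fact i"
      by (simp add: coeff_boros_moll_Q)
    \<comment> \<open>Since \<open>fact i = (k + 1) * fact k\<close>, the factor
      \<open>k + 1\<close> cancels in the first term, giving the coefficient of \<open>x Q\<close>;
      in the third it is the factor produced by \<open>pderiv\<close>.\<close>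
    also have "\<dots> = D * coeff ?rhs i"
      using D nz unfolding D_def[symmetric] distrib_right mon
      by (simp add: Suc coeff_boros_moll_Q coeff_pderiv divide_simps) (simp add: algebra_simps)
    finally show ?thesis .
  qed
  then show "coeff (boros_moll_Q (n + 1)) i = coeff ?rhs i" using D by simp
qed

end
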